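(* Let $(\mathfrak g,\varphi_i,\xi_i,\eta_i)$ be an almost $3$-contact Lie algebra with abelian structure such that $\psi=0$ and $\mathcal Z=0$. 1. If $\delta=0$, then $\mathfrak v$ is in the center of $\mathfrak g$ and therefore $\mathfrak g$ is a central extension $\mathfrak g=\mathfrak v\oplus_\theta\mathfrak h$ for a certain $J_i$-invariant $\mathfrak v$-valued $2$-cocycle $\theta$ of $\mathfrak h$, where $J_i=\varphi_i|_{\mathfrak h}$, $i=1,2,3$. 2. If $\delta\neq0$, then both $\mathfrak v$ and $\mathfrak h$ are ideals of $\mathfrak g$ and therefore $\mathfrak g=\mathfrak v\times\mathfrak h$, with $\mathfrak v\cong\mathfrak{so}(3)$, and $\mathfrak h$ carries an abelian hypercomplex structure.
   Context: An almost contact structure on a real Lie algebra $\mathfrak g$ is a triple $(\varphi,\xi,\eta)$, $\varphi\in\mathrm{End}(\mathfrak g)$, $\xi\in\mathfrak g$, $\eta\in\mathfrak g^*$, with $\varphi^2=-I+\eta\otimes\xi$ and $\eta(\xi)=1$. It is abelian if $\mathrm{ad}_\xi\circ\varphi=\varphi\circ\mathrm{ad}_\xi$ and $[\varphi X,\varphi Y]=[X,Y]$ for all $X,Y\in\operatorname{Ker}\eta$. An almost $3$-contact Lie algebra is a real Lie algebra $\mathfrak g$ of dimension $4n+3$ with three almost contact structures $(\varphi_i,\xi_i,\eta_i)$, $i=1,2,3$, such that for every even permutation $(i,j,k)$ of $(1,2,3)$: $\varphi_k=\varphi_i\varphi_j-\eta_j\otimes\xi_i=-\varphi_j\varphi_i+\eta_i\otimes\xi_j$,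 $\xi_k=\varphi_i\xi_j=-\varphi_j\xi_i$, $\eta_k=\eta_i\circ\varphi_j=-\eta_j\circ\varphi_i$. It is abelian if each $(\varphi_i,\xi_i,\eta_i)$ is abelian. Set $\mathfrak h=\bigcap_i\operatorname{Ker}\eta_i$ and $\mathfrak v=\langle\xi_1,\xi_2,\xi_3\rangle$. For an abelian structure the following are well defined: $\mathcal Z:=\varphi_i([\xi_j,\xi_k])\in\mathfrak h$ and $\delta\in\mathbb R$ with $2\delta=\eta_i([\xi_j,\xi_k])$ (independent of the even permutation $(i,j,k)$ of $(1,2,3)$), so that $[\xi_j,\xi_k]=-\varphi_i\mathcal Z+2\delta\xi_i$; and $\psi:=(\mathrm{ad}_{\xi_i}\circ\varphi_i)|_{\mathfrak h}=(\varphi_i\circ\mathrm{ad}_{\xi_i})|_{\mathfrak h}:\mathfrak h\to\mathfrak h$ (independent of $i$). An abelian hypercomplex structure on a Lie algebra is a triple $J_1,J_2,J_3$ of endomorphisms with $J_i^2=-I$, $J_1J_2=-J_2J_1=J_3$ and $[J_iX,J_iY]=[X,Y]$ for all $X,Y$ and $i$. A $\mathfrak v$-valued $2$-cocycle $\theta$ on a Lie algebra $\mathfrak h$ is a closed $\theta\in\bigwedge^2\mathfrak h^*\otimes\mathfrak v$; it is $J_i$-invariant if $\theta(J_iX,J_iY)=\theta(X,Y)$ for all $i$. The central extension $\mathfrak v\oplus_\theta\mathfrak h$ is $\mathfrak v\oplus\mathfrak h$ with $\mathfrak v$ central and bracket of $X,Y\in\mathfrak h$ equal to $\theta(X,Y)+[X,Y]_{\mathfrak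 h}$. When $\mathfrak v\subset\mathfrak z(\mathfrak g)$, $\mathfrak h$ is regarded as a Lie algebra with the bracket $[X,Y]_{\mathfrak h}$ given by the $\mathfrak h$-component of $[X,Y]$ with respect to $\mathfrak g=\mathfrak v\oplus\mathfrak h$. *)

theory Defs
  imports "HOL-Analysis.Analysis"
begin

section \<open>Lie algebras on subspaces\<close>

definition linear_map_on :: "'a::real_vector set \<Rightarrow> ('a \<Rightarrow> 'b::real_vector) \<Rightarrow> bool" where
  "linear_map_on S f \<longleftrightarrow>
     (\<forall>x\<in>S. \<forall>y\<in>S. f (x + y) = f x + f y) \<and> (\<forall>c. \<forall>x\<in>S. f (c *\<^sub>R x) = c *\<^sub>R f x)"

definition bilinear_map_on ::
    "'a::real_vector set \<Rightarrow> ('a \<Rightarrow> 'a \<Rightarrow> 'b::real_vector) \<Rightarrow> bool" where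
  "bilinear_map_on S b \<longleftrightarrow>
     (\<forall>x\<in>S. linear_map_on S (\<lambda>y. b x y)) \<and> (\<forall>y\<in>S. linear_map_on S (\<lambda>x. b x y))"

definition lie_algebra_on :: "'a::real_vector set \<Rightarrow> ('a \<Rightarrow> 'a \<Rightarrow> 'a) \<Rightarrow> bool" where
  "lie_algebra_on S br \<longleftrightarrow>
     subspace S \<and> (\<forall>x\<in>S. \<forall>y\<in>S. br x y \<in> S) \<and> bilinear_map_on S br \<and>
     (\<forall>x\<in>S. br x x = 0) \<and>
     (\<forall>x\<in>S. \<forall>y\<in>S. \<forall>z\<in>S. br x (br y z) + br y (br z x) + br z (br x y) = 0)"

definition lie_isomorphism ::
    "'a::real_vector set \<Rightarrow> ('a \<Rightarrow> 'a \<Rightarrow> 'a) \<Rightarrow> 'b::real_vector set \<Rightarrow> ('b \<Rightarrow> 'b \<Rightarrow> 'b) \<Rightarrow>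
     ('a \<Rightarrow> 'b) \<Rightarrow> bool" where
  "lie_isomorphism S br T br' f \<longleftrightarrow>
     lie_algebra_on S br \<and> lie_algebra_on T br' \<and>
     linear_map_on S f \<and> bij_betw f S T \<and>
     (\<forall>x\<in>S. \<forall>y\<in>S. f (br x y) = br' (f x) (f y))"

definition lie_isomorphic ::
    "'a::real_vector set \<Rightarrow> ('a \<Rightarrow> 'a \<Rightarrow> 'a) \<Rightarrow> 'b::real_vector set \<Rightarrow> ('b \<Rightarrow> 'b \<Rightarrow> 'b) \<Rightarrow> bool" where
  "lie_isomorphic S br T br' \<longleftrightarrow> (\<exists>f. lie_isomorphism S br T br' f)"

definition lie_center :: "('a::real_vector \<Rightarrow> 'a \<Rightarrow> 'a) \<Rightarrow> 'a set" where
  "lie_center br = {z. \<forall>x. br z x = 0}"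

definition lie_ideal :: "('a::real_vector \<Rightarrow> 'a \<Rightarrow> 'a) \<Rightarrow> 'a set \<Rightarrow> bool" where
  "lie_ideal br I \<longleftrightarrow> subspace I \<and> (\<forall>x. \<forall>y\<in>I. br x y \<in> I)"

definition so3 :: "(real^3^3) set" where
  "so3 = {A. transpose A = - A}"

definition matrix_commutator :: "real^3^3 \<Rightarrow> real^3^3 \<Rightarrow> real^3^3" where
  "matrix_commutator A B = A ** B - B ** A"

section \<open>Cocycles, central extensions, products\<close>

text \<open>Closedness is with respect to the trivial representation of the Lie algebra on
  the coefficient space \<open>V\<close>.\<close>

definition two_cocycle_on ::
    "'a::real_vector set \<Rightarrow> ('a \<Rightarrow> 'a \<Rightarrow> 'a) \<Rightarrow> 'b::real_vector set \<Rightarrow> ('a \<Rightarrow> 'a \<Rightarrow> 'b) \<Rightarrow> bool" where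
  "two_cocycle_on H br V \<theta> \<longleftrightarrow>
     (\<forall>X\<in>H. \<forall>Y\<in>H. \<theta> X Y \<in> V) \<and> bilinear_map_on H \<theta> \<and> (\<forall>X\<in>H. \<theta> X X = 0) \<and>
     (\<forall>X\<in>H. \<forall>Y\<in>H. \<forall>Z\<in>H. \<theta> (br X Y) Z + \<theta> (br Y Z) X + \<theta> (br Z X) Y = 0)"

definition invariant_form_on ::
    "'a set \<Rightarrow> ('a \<Rightarrow> 'a) \<Rightarrow> ('a \<Rightarrow> 'a \<Rightarrow> 'b) \<Rightarrow> bool" where
  "invariant_form_on H J \<theta> \<longleftrightarrow> (\<forall>X\<in>H. \<forall>Y\<in>H. \<theta> (J X) (J Y) = \<theta> X Y)"

text \<open>Both brackets are used on the carrier \<open>V \<times> H\<close>, the external direct sum.\<close>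

definition central_ext_bracket ::
    "('a \<Rightarrow> 'a \<Rightarrow> 'v) \<Rightarrow> ('a \<Rightarrow> 'a \<Rightarrow> 'a) \<Rightarrow> 'v \<times> 'a \<Rightarrow> 'v \<times> 'a \<Rightarrow> 'v \<times> 'a" where
  "central_ext_bracket \<theta> br p q = (\<theta> (snd p) (snd q), br (snd p) (snd q))"

definition product_bracket ::
    "('v \<Rightarrow> 'v \<Rightarrow> 'v) \<Rightarrow> ('a \<Rightarrow> 'a \<Rightarrow> 'a) \<Rightarrow> 'v \<times> 'a \<Rightarrow> 'v \<times> 'a \<Rightarrow> 'v \<times> 'a" where
  "product_bracket brV brH p q = (brV (fst p) (fst q), brH (snd p) (snd q))"

definition abelian_hypercomplex_on ::
    "'a::real_vector set \<Rightarrow> ('a \<Rightarrow> 'a \<Rightarrow> 'a) \<Rightarrow> ('a \<Rightarrow> 'a) \<Rightarrow> ('a \<Rightarrow> 'a) \<Rightarrow> ('a \<Rightarrow> 'a) \<Rightarrow> bool" where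
  "abelian_hypercomplex_on H br J1 J2 J3 \<longleftrightarrow>
     (\<forall>J\<in>{J1, J2, J3}. (\<forall>X\<in>H. J X \<in> H) \<and> linear_map_on H J \<and>
        (\<forall>X\<in>H. J (J X) = - X) \<and> (\<forall>X\<in>H. \<forall>Y\<in>H. br (J X) (J Y) = br X Y)) \<and>
     (\<forall>X\<in>H. J1 (J2 X) = J3 X \<and> - J2 (J1 X) = J3 X)"

section \<open>Almost contact and almost 3-contact structures\<close>

definition almost_contact ::
    "('a::real_vector \<Rightarrow> 'a) \<Rightarrow> 'a \<Rightarrow> ('a \<Rightarrow> real) \<Rightarrow> bool" where
  "almost_contact \<phi> \<xi> \<eta> \<longleftrightarrow>
     linear \<phi> \<and> linear \<eta> \<and> (\<forall>X. \<phi> (\<phi> X) = - X + \<eta> X *\<^sub>R \<xi>) \<and> \<eta> \<xi> = 1"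

definition abelian_almost_contact ::
    "('a::real_vector \<Rightarrow> 'a \<Rightarrow> 'a) \<Rightarrow> ('a \<Rightarrow> 'a) \<Rightarrow> 'a \<Rightarrow> ('a \<Rightarrow> real) \<Rightarrow> bool" where
  "abelian_almost_contact br \<phi> \<xi> \<eta> \<longleftrightarrow>
     (\<forall>X. br \<xi> (\<phi> X) = \<phi> (br \<xi> X)) \<and>
     (\<forall>X Y. \<eta> X = 0 \<longrightarrow> \<eta> Y = 0 \<longrightarrow> br (\<phi> X) (\<phi> Y) = br X Y)"

definition even_triples :: "(nat \<times> nat \<times> nat) set" where
  "even_triples = {(1, 2, 3), (2, 3, 1), (3, 1, 2)}"

text \<open>Families are indexed by \<open>nat\<close>; only the values at 1, 2, 3 matter. In Isabelle/HOL
  \<open>dim\<close> is 0 on infinite-dimensional spaces, so the dimension condition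
  below entails finite dimension.\<close>

definition almost_3_contact_lie_algebra ::
    "nat \<Rightarrow> ('a::real_vector \<Rightarrow> 'a \<Rightarrow> 'a) \<Rightarrow> (nat \<Rightarrow> 'a \<Rightarrow> 'a) \<Rightarrow> (nat \<Rightarrow> 'a) \<Rightarrow> (nat \<Rightarrow> 'a \<Rightarrow> real) \<Rightarrow> bool"
  where
  "almost_3_contact_lie_algebra n br \<phi> \<xi> \<eta> \<longleftrightarrow>
     lie_algebra_on UNIV br \<and> dim (UNIV :: 'a set) = 4 * n + 3 \<and>
     (\<forall>i\<in>{1, 2, 3}. almost_contact (\<phi> i) (\<xi> i) (\<eta> i)) \<and>
     (\<forall>(i, j, k)\<in>even_triples.
        (\<forall>X. \<phi> k X = \<phi> i (\<phi> j X) - \<eta> j X *\<^sub>R \<xi> i \<and>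
             \<phi> k X = - \<phi> j (\<phi> i X) + \<eta> i X *\<^sub>R \<xi> j) \<and>
        \<xi> k = \<phi> i (\<xi> j) \<and> \<xi> k = - \<phi> j (\<xi> i) \<and>
        (\<forall>X. \<eta> k X = \<eta> i (\<phi> j X) \<and> \<eta> k X = - \<eta> j (\<phi> i X)))"

definition abelian_3_contact ::
    "('a::real_vector \<Rightarrow> 'a \<Rightarrow> 'a) \<Rightarrow> (nat \<Rightarrow> 'a \<Rightarrow> 'a) \<Rightarrow> (nat \<Rightarrow> 'a) \<Rightarrow> (nat \<Rightarrow> 'a \<Rightarrow> real) \<Rightarrow> bool" where
  "abelian_3_contact br \<phi> \<xi> \<eta> \<longleftrightarrow>
     (\<forall>i\<in>{1, 2, 3}. abelian_almost_contact br (\<phi> i) (\<xi> i) (\<eta> i))"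

definition horizontal :: "(nat \<Rightarrow> 'a::real_vector \<Rightarrow> real) \<Rightarrow> 'a set" where
  "horizontal \<eta> = {X. \<forall>i\<in>{1, 2, 3}. \<eta> i X = 0}"

definition vertical :: "(nat \<Rightarrow> 'a::real_vector) \<Rightarrow> 'a set" where
  "vertical \<xi> = span {\<xi> 1, \<xi> 2, \<xi> 3}"

definition hor_component ::
    "(nat \<Rightarrow> 'a::real_vector) \<Rightarrow> (nat \<Rightarrow> 'a \<Rightarrow> real) \<Rightarrow> 'a \<Rightarrow> 'a" where
  "hor_component \<xi> \<eta> X = (THE W. W \<in> horizontal \<eta> \<and> X - W \<in> vertical \<xi>)"

definition hor_bracket ::
    "('a::real_vector \<Rightarrow> 'a \<Rightarrow> 'a) \<Rightarrow> (nat \<Rightarrow> 'a) \<Rightarrow> (nat \<Rightarrow> 'a \<Rightarrow> real) \<Rightarrow> 'a \<Rightarrow> 'a \<Rightarrow> 'a" where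
  "hor_bracket br \<xi> \<eta> X Y = hor_component \<xi> \<eta> (br X Y)"

text \<open>The invariants \<open>\<Z>\<close>, \<open>\<delta>\<close> and \<open>\<psi>\<close> are defined from one choice of indices; that
  every other choice gives the same result for abelian structures is shown below.\<close>

definition Z_vec :: "('a::real_vector \<Rightarrow> 'a \<Rightarrow> 'a) \<Rightarrow> (nat \<Rightarrow> 'a \<Rightarrow> 'a) \<Rightarrow> (nat \<Rightarrow> 'a) \<Rightarrow> 'a" where
  "Z_vec br \<phi> \<xi> = \<phi> 1 (br (\<xi> 2) (\<xi> 3))"

definition delta :: "('a::real_vector \<Rightarrow> 'a \<Rightarrow> 'a) \<Rightarrow> (nat \<Rightarrow> 'a) \<Rightarrow> (nat \<Rightarrow> 'a \<Rightarrow> real) \<Rightarrow> real" where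
  "delta br \<xi> \<eta> = \<eta> 1 (br (\<xi> 2) (\<xi> 3)) / 2"

definition psi ::
    "('a::real_vector \<Rightarrow> 'a \<Rightarrow> 'a) \<Rightarrow> (nat \<Rightarrow> 'a \<Rightarrow> 'a) \<Rightarrow> (nat \<Rightarrow> 'a) \<Rightarrow> 'a \<Rightarrow> 'a" where
  "psi br \<phi> \<xi> X = br (\<xi> 1) (\<phi> 1 X)"

section \<open>Well-definedness\<close>

context
  fixes n :: nat and br :: "'a::real_vector \<Rightarrow> 'a \<Rightarrow> 'a" and \<phi> \<xi> \<eta>
  assumes str: "almost_3_contact_lie_algebra n br \<phi> \<xi> \<eta>"
begin

lemma ac3_basic:
  assumes "i \<in> {1, 2, 3}"
  shows "linear (\<phi> i)" "linear (\<eta> i)" "\<phi> i (\<phi> i X) = - X + \<eta> i X *\<^sub>R \<xi> i" "\<eta> i (\<xi> i) = 1"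
  using str assms unfolding almost_3_contact_lie_algebra_def almost_contact_def by blast+

lemma ac3_cyclic:
  assumes "(i, j, k) \<in> even_triples"
  shows "\<phi> k X = \<phi> i (\<phi> j X) - \<eta> j X *\<^sub>R \<xi> i" "\<phi> k X = - \<phi> j (\<phi> i X) + \<eta> i X *\<^sub>R \<xi> j"
    "\<xi> k = \<phi> i (\<xi> j)" "\<xi> k = - \<phi> j (\<xi> i)" "\<eta> k X = \<eta> i (\<phi> j X)" "\<eta> k X = - \<eta> j (\<phi> i X)"
  using str assms unfolding almost_3_contact_lie_algebra_def by blast+

lemma br_linear: "linear (br X)" "linear (\<lambda>X. br X Y)"
  using str unfolding almost_3_contact_lie_algebra_def lie_algebra_on_def
    bilinear_map_on_def linear_map_on_def by (auto intro!: linearI)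

lemma br_alt: "br X X = 0"
  using str unfolding almost_3_contact_lie_algebra_def lie_algebra_on_def by blast

lemma br_anti: "br X Y = - br Y X"
proof -
  have "br (X + Y) (X + Y) = br X X + br X Y + (br Y X + br Y Y)"
    using linear_add[OF br_linear(1)] linear_add[OF br_linear(2)] by simp
  then show ?thesis by (simp add: br_alt eq_neg_iff_add_eq_0)
qed

lemma even_triples_rot:
  assumes "(i, j, k) \<in> even_triples"
  shows "(j, k, i) \<in> even_triples" "(k, i, j) \<in> even_triples"
    "i \<in> {1, 2, 3}" "j \<in> {1, 2, 3}" "k \<in> {1, 2, 3}"
  using assms unfolding even_triples_def by auto

lemma phi_xi: assumes i: "i \<in> {1, 2, 3}" shows "\<phi> i (\<xi> i) = 0"
proof -
  have a: "\<phi> i (\<phi> i (\<xi> i)) = 0" using ac3_basic(3,4)[OF i] by simp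
  have "\<phi> i (\<phi> i (\<phi> i (\<xi> i))) = - \<phi> i (\<xi> i) + \<eta> i (\<phi> i (\<xi> i)) *\<^sub>R \<xi> i"
    by (rule ac3_basic(3)[OF i])
  then have b: "\<phi> i (\<xi> i) = \<eta> i (\<phi> i (\<xi> i)) *\<^sub>R \<xi> i"
    using a ac3_basic(1)[OF i] by (simp add: linear_0)
  have "\<phi> i (\<phi> i (\<xi> i)) = \<eta> i (\<phi> i (\<xi> i)) *\<^sub>R \<phi> i (\<xi> i)"
    by (subst b) (simp add: linear_scale[OF ac3_basic(1)[OF i]])
  with a have "\<eta> i (\<phi> i (\<xi> i)) = 0 \<or> \<phi> i (\<xi> i) = 0" by simp
  with b show ?thesis by auto
qed

lemma eta_phi: assumes i: "i \<in> {1, 2, 3}" shows "\<eta> i (\<phi> i X) = 0"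
proof -
  have "\<phi> i (\<phi> i (\<phi> i X)) = - \<phi> i X + \<eta> i (\<phi> i X) *\<^sub>R \<xi> i" using ac3_basic[OF i] by blast
  moreover have "\<phi> i (\<phi> i (\<phi> i X)) = \<phi> i (- X + \<eta> i X *\<^sub>R \<xi> i)" using ac3_basic(3)[OF i] by simp
  moreover have "\<dots> = - \<phi> i X"
    using ac3_basic(1)[OF i] phi_xi[OF i] by (simp add: linear_add linear_diff linear_scale linear_neg)
  ultimately have "\<eta> i (\<phi> i X) *\<^sub>R \<xi> i = 0" by simp
  moreover have "\<xi> i \<noteq> 0" using ac3_basic(4)[OF i] ac3_basic(2)[OF i] linear_0 by fastforce
  ultimately show ?thesis by simp
qed

lemma eta_xi_even:
  assumes e: "(i, j, k) \<in> even_triples"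
  shows "\<eta> i (\<xi> j) = 0" "\<eta> i (\<xi> k) = 0"
proof -
  note r = even_triples_rot[OF e]
  have "\<xi> k = \<phi> i (\<xi> j)" "\<xi> j = - \<phi> i (\<xi> k)"
    using ac3_cyclic(3)[OF e] ac3_cyclic(4)[OF r(2)] by auto
  then show "\<eta> i (\<xi> k) = 0" "\<eta> i (\<xi> j) = 0"
    using eta_phi[OF r(3)] ac3_basic(2)[OF r(3)] by (metis, metis linear_neg neg_equal_0_iff_equal)
qed

lemma eta_xi:
  assumes "i \<in> {1, 2, 3}" "j \<in> {1, 2, 3}"
  shows "\<eta> i (\<xi> j) = (if i = j then 1 else 0)"
proof -
  have e: "(1, 2, 3) \<in> even_triples" "(2, 3, 1) \<in> even_triples" "(3, 1, 2) \<in> even_triples"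
    by (auto simp: even_triples_def)
  show ?thesis
    using assms e[THEN eta_xi_even(1)] e[THEN eta_xi_even(2)] ac3_basic(4)[of 1] ac3_basic(4)[of 2]
      ac3_basic(4)[of 3] by auto
qed

lemma hor_component_eq:
  shows "hor_component \<xi> \<eta> X = X - (\<Sum>i\<in>{1, 2, 3}. \<eta> i X *\<^sub>R \<xi> i)" (is "_ = X - ?V X")
    and "hor_component \<xi> \<eta> X \<in> horizontal \<eta>"
    and "X - hor_component \<xi> \<eta> X \<in> vertical \<xi>"
proof -
  have V: "?V Y \<in> vertical \<xi>" for Y
    unfolding vertical_def by (intro span_sum span_scale span_base) auto
  have W: "X - ?V X \<in> horizontal \<eta>"
  proof -
    have "\<eta> i (X - ?V X) = 0" if "i \<in> {1, 2, 3}" for i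
      using that ac3_basic(2)[OF that]
      by (auto simp: linear_diff linear_add linear_scale eta_xi)
    then show ?thesis by (simp add: horizontal_def)
  qed
  have VX: "X - (X - ?V X) \<in> vertical \<xi>"
    using V[of X] by (simp only: diff_diff_eq2 add_diff_cancel_left')
  have lin: "linear ?V"
    by (rule linearI) (auto simp: ac3_basic(2) linear_add linear_scale algebra_simps)
  have fixV: "U = ?V U" if "U \<in> vertical \<xi>" for U
    using that unfolding vertical_def
  proof (induction U rule: span_induct)
    case base
    show ?case
    proof (rule subspaceI)
      show "0 \<in> {U. U = ?V U}" using linear_0[OF lin] by (simp only: mem_Collect_eq)
      show "x + y \<in> {U. U = ?V U}" if "x \<in> {U. U = ?V U}" "y \<in> {U. U = ?V U}" for x y
        using that linear_add[OF lin, of x y] by (simp only: mem_Collect_eq)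
      show "c *\<^sub>R x \<in> {U. U = ?V U}" if "x \<in> {U. U = ?V U}" for c x
        using that linear_scale[OF lin, of c x] by (simp only: mem_Collect_eq)
    qed
  next
    case (step x)
    then show ?case by (auto simp: eta_xi)
  qed
  have uniq: "U = X - ?V X" if "U \<in> horizontal \<eta>" "X - U \<in> vertical \<xi>" for U
  proof -
    have "?V (X - U) = ?V X"
      using that(1) by (auto simp: horizontal_def ac3_basic(2) linear_diff)
    then show ?thesis using fixV[OF that(2)] by (simp add: algebra_simps)
  qed
  show eq: "hor_component \<xi> \<eta> X = X - ?V X"
    unfolding hor_component_def by (rule the_equality) (use W VX uniq in blast)+
  show "hor_component \<xi> \<eta> X \<in> horizontal \<eta>" "X - hor_component \<xi> \<eta> X \<in> vertical \<xi>"
    unfolding eq using W VX by blast+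
qed

lemma phi_horizontal:
  assumes i: "i \<in> {1, 2, 3}" and X: "X \<in> horizontal \<eta>"
  shows "\<phi> i X \<in> horizontal \<eta>"
proof -
  obtain j k where e: "(i, j, k) \<in> even_triples" using i by (auto simp: even_triples_def)
  note r = even_triples_rot[OF e]
  have "\<eta> i X = 0" "\<eta> j X = 0" "\<eta> k X = 0" using X r by (auto simp: horizontal_def)
  then have "\<eta> i (\<phi> i X) = 0" "\<eta> j (\<phi> i X) = 0" "\<eta> k (\<phi> i X) = 0"
    using eta_phi[OF i] ac3_cyclic(6)[OF e, of X] ac3_cyclic(5)[OF r(2), of X] by auto
  then show ?thesis using e by (auto simp: horizontal_def even_triples_def)
qed

context
  assumes ab: "abelian_3_contact br \<phi> \<xi> \<eta>"
begin

lemma ab_basic: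
  assumes "i \<in> {1, 2, 3}"
  shows "br (\<xi> i) (\<phi> i X) = \<phi> i (br (\<xi> i) X)"
    "\<eta> i X = 0 \<Longrightarrow> \<eta> i Y = 0 \<Longrightarrow> br (\<phi> i X) (\<phi> i Y) = br X Y"
  using ab assms unfolding abelian_3_contact_def abelian_almost_contact_def by blast+

lemma reeb_step:
  assumes e: "(i, j, k) \<in> even_triples"
  shows "br (\<xi> i) (\<xi> j) = \<phi> i (br (\<xi> k) (\<xi> i))" "\<eta> i (br (\<xi> k) (\<xi> i)) = 0"
    "\<eta> i (br (\<xi> i) (\<xi> j)) = 0"
proof -
  note r = even_triples_rot[OF e]
  have "br (\<xi> i) (\<phi> i (\<xi> k)) = \<phi> i (br (\<xi> i) (\<xi> k))" by (rule ab_basic(1)[OF r(3)])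
  moreover have "\<phi> i (\<xi> k) = - \<xi> j" using ac3_cyclic(4)[OF r(2)] by simp
  ultimately show 1: "br (\<xi> i) (\<xi> j) = \<phi> i (br (\<xi> k) (\<xi> i))"
    using br_linear(1)[of "\<xi> i"] br_anti[of "\<xi> i" "\<xi> k"] ac3_basic(1)[OF r(3)]
    by (simp add: linear_neg)
  then show "\<eta> i (br (\<xi> i) (\<xi> j)) = 0" by (simp add: eta_phi[OF r(3)])
  have "br (\<xi> i) (\<phi> i (\<xi> j)) = \<phi> i (br (\<xi> i) (\<xi> j))" by (rule ab_basic(1)[OF r(3)])
  then have "br (\<xi> i) (\<xi> k) = \<phi> i (br (\<xi> i) (\<xi> j))" using ac3_cyclic(3)[OF e] by simp
  then show "\<eta> i (br (\<xi> k) (\<xi> i)) = 0"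
    using eta_phi[OF r(3)] br_anti[of "\<xi> k" "\<xi> i"] ac3_basic(2)[OF r(3)] by (simp add: linear_neg)
qed

lemma Z_delta_step:
  assumes e: "(i, j, k) \<in> even_triples"
  shows "\<phi> k (br (\<xi> i) (\<xi> j)) = \<phi> j (br (\<xi> k) (\<xi> i))"
    "\<eta> k (br (\<xi> i) (\<xi> j)) = \<eta> j (br (\<xi> k) (\<xi> i))"
proof -
  note r = even_triples_rot[OF e]
  show "\<phi> k (br (\<xi> i) (\<xi> j)) = \<phi> j (br (\<xi> k) (\<xi> i))"
    using reeb_step[OF e] ac3_cyclic(1)[OF r(2), of "br (\<xi> k) (\<xi> i)"] by simp
  show "\<eta> k (br (\<xi> i) (\<xi> j)) = \<eta> j (br (\<xi> k) (\<xi> i))"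
    using reeb_step[OF e] ac3_cyclic(5)[OF r(2), of "br (\<xi> k) (\<xi> i)"] by simp
qed

lemma Z_delta_well_defined:
  assumes e: "(i, j, k) \<in> even_triples"
  shows "\<phi> i (br (\<xi> j) (\<xi> k)) = Z_vec br \<phi> \<xi>"
    and "\<eta> i (br (\<xi> j) (\<xi> k)) = 2 * delta br \<xi> \<eta>"
    and "br (\<xi> j) (\<xi> k) = - \<phi> i (Z_vec br \<phi> \<xi>) + (2 * delta br \<xi> \<eta>) *\<^sub>R \<xi> i"
    and "Z_vec br \<phi> \<xi> \<in> horizontal \<eta>"
proof -
  have t: "(1, 2, 3) \<in> even_triples" "(2, 3, 1) \<in> even_triples" "(3, 1, 2) \<in> even_triples"
    by (auto simp: even_triples_def)
  have all: "\<phi> i (br (\<xi> j) (\<xi> k)) = Z_vec br \<phi> \<xi> \<and> \<eta> i (br (\<xi> j) (\<xi> k)) = 2 * delta br \<xi> \<eta>"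
    if "(i, j, k) \<in> even_triples" for i j k
    using that t[THEN Z_delta_step(1)] t[THEN Z_delta_step(2)]
    by (auto simp: even_triples_def Z_vec_def delta_def)
  show 1: "\<phi> i (br (\<xi> j) (\<xi> k)) = Z_vec br \<phi> \<xi>" and 2: "\<eta> i (br (\<xi> j) (\<xi> k)) = 2 * delta br \<xi> \<eta>"
    using all[OF e] by auto
  show "br (\<xi> j) (\<xi> k) = - \<phi> i (Z_vec br \<phi> \<xi>) + (2 * delta br \<xi> \<eta>) *\<^sub>R \<xi> i"
    using ac3_basic(3)[OF even_triples_rot(3)[OF e], of "br (\<xi> j) (\<xi> k)"] 1 2 by simp
  have "\<eta> a (Z_vec br \<phi> \<xi>) = 0" if "(a, b, c) \<in> even_triples" for a b c
    using all[OF that] eta_phi[OF even_triples_rot(3)[OF that]] by metis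
  then show "Z_vec br \<phi> \<xi> \<in> horizontal \<eta>" using t unfolding horizontal_def by blast
qed

lemma psi_step:
  assumes e: "(i, j, k) \<in> even_triples" and X: "X \<in> horizontal \<eta>"
  shows "br (\<xi> k) (\<phi> k X) = br (\<xi> j) (\<phi> j X)"
proof -
  note r = even_triples_rot[OF e]
  have "\<eta> i (\<phi> j X) = 0" using phi_horizontal[OF r(4) X] r(3) by (auto simp: horizontal_def)
  then have "br (\<phi> i (\<xi> j)) (\<phi> i (\<phi> j X)) = br (\<xi> j) (\<phi> j X)"
    using ab_basic(2)[OF r(3)] eta_xi_even(1)[OF e] by blast
  moreover have "\<phi> i (\<phi> j X) = \<phi> k X"
    using ac3_cyclic(1)[OF e, of X] X r(4) by (auto simp: horizontal_def)
  ultimately show ?thesis using ac3_cyclic(3)[OF e] by simp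
qed

lemma psi_well_defined:
  assumes i: "i \<in> {1, 2, 3}" and X: "X \<in> horizontal \<eta>"
  shows "br (\<xi> i) (\<phi> i X) = psi br \<phi> \<xi> X"
    and "\<phi> i (br (\<xi> i) X) = psi br \<phi> \<xi> X"
    and "psi br \<phi> \<xi> X \<in> horizontal \<eta>"
proof -
  have t: "(1, 2, 3) \<in> even_triples" "(2, 3, 1) \<in> even_triples" "(3, 1, 2) \<in> even_triples"
    by (auto simp: even_triples_def)
  have all: "br (\<xi> i) (\<phi> i X) = psi br \<phi> \<xi> X" if "i \<in> {1, 2, 3}" for i
    using that t[THEN psi_step, OF X] by (auto simp: psi_def)
  show "br (\<xi> i) (\<phi> i X) = psi br \<phi> \<xi> X" by (rule all[OF i])
  then show "\<phi> i (br (\<xi> i) X) = psi br \<phi> \<xi> X" using ab_basic(1)[OF i] by simp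
  have "\<eta> a (psi br \<phi> \<xi> X) = 0" if "a \<in> {1, 2, 3}" for a
    using all[OF that] ab_basic(1)[OF that, of X] eta_phi[OF that] by metis
  then show "psi br \<phi> \<xi> X \<in> horizontal \<eta>" unfolding horizontal_def by blast
qed

end

end

end

theory Submission
  imports Defs
begin

text \<open>The condition \<open>\<psi> = 0\<close> says that \<open>\<xi>\<^sub>i\<close> commutes with \<open>\<hh>\<close>, because \<open>\<phi>\<^sub>i\<close> maps \<open>\<hh>\<close> onto itself, and
  \<open>\<Z> = 0\<close> says that \<open>[\<xi>\<^sub>j, \<xi>\<^sub>k] = 2\<delta>\<xi>\<^sub>i\<close>. So \<open>\<vv>\<close> commutes with \<open>\<hh>\<close> and carries \<open>2\<delta>\<close> times the cross
  product of \<open>\<real>\<^sup>3\<close>. If \<open>\<delta> = 0\<close>, then \<open>\<vv>\<close> is central and the cocycle is the vertical part of the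
  bracket. If \<open>\<delta> \<noteq> 0\<close>, then by the Jacobi identity \<open>[X, Y]\<close> commutes with every \<open>\<xi>\<^sub>i\<close> for
  \<open>X, Y \<in> \<hh>\<close>, which forces its vertical part to vanish.\<close>

section \<open>Transport of a Lie algebra structure along a linear bijection\<close>

text \<open>Since \<open>f\<close> is linear, injective and compatible with the brackets, every law
  of \<open>br\<close> on \<open>S\<close> can be checked after applying \<open>f\<close>, where it
  becomes the same law for \<open>br'\<close>. Thus the Lie axioms for the external brackets on
  \<open>vertical \<xi> \<times> horizontal \<eta>\<close> come for free from those of the
  target.\<close>

lemma lie_isomorphism_pullback:
  assumes T: "lie_algebra_on T br'" and S: "subspace S"
    and cl: "\<And>x y. x \<in> S \<Longrightarrow> y \<in> S \<Longrightarrow> br x y \<in> S"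
    and lin: "linear_map_on S f" and bij: "bij_betw f S T"
    and hom: "\<And>x y. x \<in> S \<Longrightarrow> y \<in> S \<Longrightarrow> f (br x y) = br' (f x) (f y)"
  shows "lie_isomorphism S br T br' f"
proof -
  have fT: "f x \<in> T" if "x \<in> S" for x using that bij by (auto simp: bij_betw_def)
  have inj: "x = y" if "f x = f y" "x \<in> S" "y \<in> S" for x y
    using that bij by (auto simp: bij_betw_def inj_on_def)
  have add: "f (x + y) = f x + f y" if "x \<in> S" "y \<in> S" for x y
    using lin that by (auto simp: linear_map_on_def)
  have scale: "f (c *\<^sub>R x) = c *\<^sub>R f x" if "x \<in> S" for c x
    using lin that by (auto simp: linear_map_on_def)
  have S0: "0 \<in> S" and Sadd: "\<And>x y. x \<in> S \<Longrightarrow> y \<in> S \<Longrightarrow> x + y \<in> S"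
    and Sscale: "\<And>c x. x \<in> S \<Longrightarrow> c *\<^sub>R x \<in> S"
    using S by (auto simp: subspace_0 subspace_add subspace_scale)
  have f0: "f 0 = 0" using scale[OF S0, of 0] by simp
  note closed = S0 Sadd Sscale cl fT add scale f0 hom
  have bil: "bilinear_map_on T br'" and alt: "\<And>x. x \<in> T \<Longrightarrow> br' x x = 0"
    and jac: "\<And>x y z. x \<in> T \<Longrightarrow> y \<in> T \<Longrightarrow> z \<in> T \<Longrightarrow>
      br' x (br' y z) + br' y (br' z x) + br' z (br' x y) = 0"
    using T unfolding lie_algebra_on_def by blast+
  have "bilinear_map_on S br"
    unfolding bilinear_map_on_def linear_map_on_def
  proof (intro conjI ballI allI)
    fix x y z and c :: real
    assume x: "x \<in> S" and y: "y \<in> S"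
    show "br x (c *\<^sub>R y) = c *\<^sub>R br x y"
      by (rule inj) (use bil x y in \<open>simp_all add: closed bilinear_map_on_def linear_map_on_def\<close>)
    show "br (c *\<^sub>R y) x = c *\<^sub>R br y x"
      by (rule inj) (use bil x y in \<open>simp_all add: closed bilinear_map_on_def linear_map_on_def\<close>)
    assume z: "z \<in> S"
    show "br x (y + z) = br x y + br x z"
      by (rule inj) (use bil x y z in \<open>simp_all add: closed bilinear_map_on_def linear_map_on_def\<close>)
    show "br (y + z) x = br y x + br z x"
      by (rule inj) (use bil x y z in \<open>simp_all add: closed bilinear_map_on_def linear_map_on_def\<close>)
  qed
  moreover have "br x x = 0" if "x \<in> S" for x
    by (rule inj) (use that alt in \<open>simp_all add: closed\<close>)
  moreover have "br x (br y z) + br y (br z x) + br z (br x y) = 0"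
    if "x \<in> S" "y \<in> S" "z \<in> S" for x y z
    by (rule inj) (use that jac in \<open>simp_all add: closed\<close>)
  ultimately have "lie_algebra_on S br" using S cl unfolding lie_algebra_on_def by blast
  then show ?thesis using T lin bij hom unfolding lie_isomorphism_def by blast
qed

section \<open>The algebra so(3) as 3-space with the cross product\<close>

text \<open>The matrix of the map sending \<open>v\<close> to \<open>cross3 u v\<close> in the
  standard basis.\<close>

definition skew_matrix :: "real^3 \<Rightarrow> real^3^3" where
  "skew_matrix u = vector [vector [0, - u$3, u$2], vector [u$3, 0, - u$1], vector [- u$2, u$1, 0]]"

lemma linear_skew_matrix: "linear skew_matrix"
  by (rule linearI) (simp_all add: skew_matrix_def vec_eq_iff forall_3)

lemma bij_betw_skew_matrix: "bij_betw skew_matrix UNIV so3"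
proof -
  have "inj skew_matrix"
    by (rule injI) (simp add: skew_matrix_def vec_eq_iff forall_3)
  moreover have "skew_matrix u \<in> so3" for u
    by (simp add: so3_def skew_matrix_def transpose_def vec_eq_iff forall_3)
  moreover have "A \<in> range skew_matrix" if "A \<in> so3" for A
  proof
    have skew: "A $ j $ i = - A $ i $ j" for i j
    proof -
      have "transpose A $ i $ j = (- A) $ i $ j" using that by (simp only: so3_def mem_Collect_eq)
      then show ?thesis by (simp add: transpose_def)
    qed
    have "A $ i $ i = 0" for i
      using skew[of i i] by linarith
    then show "A = skew_matrix (vector [A$3$2, A$1$3, A$2$1])"
      using skew[of 1 2] skew[of 3 1] skew[of 2 3]
      by (simp add: skew_matrix_def vec_eq_iff forall_3)
  qed simp
  ultimately show ?thesis unfolding bij_betw_def by blast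
qed

text \<open>In operator form this is the Jacobi identity of the cross product; it is checked entry
  by entry.\<close>

lemma skew_matrix_cross3:
  "skew_matrix (cross3 u v) = matrix_commutator (skew_matrix u) (skew_matrix v)"
  by (simp add: skew_matrix_def matrix_commutator_def cross3_def matrix_matrix_mult_def vec_eq_iff
      forall_3 sum_3 algebra_simps)

text \<open>As the range of \<open>skew_matrix\<close>, \<open>so3\<close> is a subspace, and
  \<open>skew_matrix_cross3\<close> shows that it is closed under commutators. The Jacobi identity
  is associativity of the matrix product.\<close>

lemma lie_algebra_so3: "lie_algebra_on so3 matrix_commutator"
proof -
  have range: "so3 = range skew_matrix"
    using bij_betw_skew_matrix by (simp add: bij_betw_def)
  have sub: "subspace so3"
    unfolding range by (rule linear_subspace_image[OF linear_skew_matrix subspace_UNIV])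
  have cl: "matrix_commutator A B \<in> so3" if "A \<in> so3" "B \<in> so3" for A B
    using that unfolding range by (auto simp: skew_matrix_cross3[symmetric])
  have lin: "linear (\<lambda>B. A ** B)" "linear (\<lambda>B. B ** A)" for A :: "real^3^3"
    by (rule linearI; simp add: matrix_matrix_mult_def vec_eq_iff sum.distrib sum_distrib_left
        algebra_simps)+
  have "bilinear_map_on so3 matrix_commutator"
    by (simp add: bilinear_map_on_def linear_map_on_def matrix_commutator_def
        linear_add[OF lin(1)] linear_add[OF lin(2)] linear_scale[OF lin(1)]
        linear_scale[OF lin(2)] scaleR_diff_right)
  moreover have "matrix_commutator A (matrix_commutator B C) +
      matrix_commutator B (matrix_commutator C A) + matrix_commutator C (matrix_commutator A B) = 0"
    for A B C
    by (simp add: matrix_commutator_def linear_diff[OF lin(1)] linear_diff[OF lin(2)]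
        matrix_mul_assoc)
  ultimately show ?thesis
    using sub cl by (auto simp: lie_algebra_on_def matrix_commutator_def)
qed

section \<open>The splitting into vertical and horizontal parts\<close>

context
  fixes n :: nat and br :: "'a::real_vector \<Rightarrow> 'a \<Rightarrow> 'a" and \<phi> \<xi> \<eta>
  assumes str: "almost_3_contact_lie_algebra n br \<phi> \<xi> \<eta>"
begin

lemma lie_algebra_UNIV: "lie_algebra_on UNIV br"
  using str unfolding almost_3_contact_lie_algebra_def by blast

lemma linear_hor_component: "linear (hor_component \<xi> \<eta>)"
  by (rule linearI)
    (simp_all add: hor_component_eq(1)[OF str] linear_add linear_scale ac3_basic(2)[OF str]
      algebra_simps)

lemma hor_component_vertical:
  assumes "U \<in> vertical \<xi>" shows "hor_component \<xi> \<eta> U = 0"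
proof (rule linear_eq_0_on_span[OF linear_hor_component])
  show "U \<in> span {\<xi> 1, \<xi> 2, \<xi> 3}" using assms by (simp add: vertical_def)
  show "hor_component \<xi> \<eta> X = 0" if "X \<in> {\<xi> 1, \<xi> 2, \<xi> 3}" for X
    using that by (auto simp: hor_component_eq(1)[OF str] eta_xi[OF str])
qed

lemma hor_component_horizontal:
  assumes "X \<in> horizontal \<eta>" shows "hor_component \<xi> \<eta> X = X"
  using assms by (simp add: hor_component_eq(1)[OF str] horizontal_def)

text \<open>The horizontal component of \<open>U\<close> vanishes, and by its explicit formula it is
  \<open>U\<close> minus this sum.\<close>

lemma vertical_expansion:
  assumes "U \<in> vertical \<xi>" shows "U = \<eta> 1 U *\<^sub>R \<xi> 1 + \<eta> 2 U *\<^sub>R \<xi> 2 + \<eta> 3 U *\<^sub>R \<xi> 3"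
  using hor_component_vertical[OF assms] hor_component_eq(1)[OF str, of U]
  by (simp add: add.assoc)

lemma subspace_vertical: "subspace (vertical \<xi>)"
  by (simp add: vertical_def)

lemma subspace_horizontal: "subspace (horizontal \<eta>)"
  by (rule subspaceI)
    (simp_all add: horizontal_def linear_0 linear_add linear_scale ac3_basic(2)[OF str])

lemma xi_vertical: "i \<in> {1, 2, 3} \<Longrightarrow> \<xi> i \<in> vertical \<xi>"
  unfolding vertical_def by (auto intro: span_base)

text \<open>The direct sum decomposition as a bijection; it underlies both isomorphisms onto the
  whole algebra.\<close>

lemma bij_betw_vertical_horizontal:
  "bij_betw (\<lambda>(U, X). U + X) (vertical \<xi> \<times> horizontal \<eta>) UNIV"
proof (rule bij_betw_byWitness[where f' = "\<lambda>X. (X - hor_component \<xi> \<eta> X, hor_component \<xi> \<eta> X)"])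
qed (auto simp: linear_add[OF linear_hor_component] hor_component_vertical
    hor_component_horizontal hor_component_eq(2,3)[OF str])

lemma linear_map_on_add: "linear_map_on S (\<lambda>(U::'a, X). U + X)"
  by (auto simp: linear_map_on_def scaleR_add_right)

text \<open>On horizontal vectors all terms containing some \<open>\<eta> i\<close> drop out, so the
  almost 3-contact identities become the quaternionic ones. That \<open>br\<close> maps pairs of
  horizontal vectors to horizontal vectors is a separate matter, settled in
  \<open>br_horizontal_closed\<close>.\<close>

lemma abelian_hypercomplex_horizontal:
  assumes ab: "abelian_3_contact br \<phi> \<xi> \<eta>"
  shows "abelian_hypercomplex_on (horizontal \<eta>) br (\<phi> 1) (\<phi> 2) (\<phi> 3)"
proof -
  have H: "\<eta> i X = 0" if "i \<in> {1, 2, 3}" "X \<in> horizontal \<eta>" for i X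
    using that by (auto simp: horizontal_def)
  have 1: "(\<forall>X\<in>horizontal \<eta>. \<phi> i X \<in> horizontal \<eta>) \<and> linear_map_on (horizontal \<eta>) (\<phi> i) \<and>
      (\<forall>X\<in>horizontal \<eta>. \<phi> i (\<phi> i X) = - X) \<and>
      (\<forall>X\<in>horizontal \<eta>. \<forall>Y\<in>horizontal \<eta>. br (\<phi> i X) (\<phi> i Y) = br X Y)"
    if i: "i \<in> {1, 2, 3}" for i
    using phi_horizontal[OF str i] ac3_basic(1,3)[OF str i] ab_basic(2)[OF str ab i] H[OF i]
    by (simp add: linear_map_on_def linear_add linear_scale)
  have e: "(1, 2, 3) \<in> even_triples" by (simp add: even_triples_def)
  have "\<phi> 1 (\<phi> 2 X) = \<phi> 3 X" "- \<phi> 2 (\<phi> 1 X) = \<phi> 3 X" if "X \<in> horizontal \<eta>" for X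
    using ac3_cyclic(1,2)[OF str e, of X] H[of 1 X] H[of 2 X] that by auto
  then show ?thesis using 1 unfolding abelian_hypercomplex_on_def by auto
qed

section \<open>Brackets when \<psi> and \<Z> vanish\<close>

context
  assumes ab: "abelian_3_contact br \<phi> \<xi> \<eta>"
    and psi0: "\<forall>X\<in>horizontal \<eta>. psi br \<phi> \<xi> X = 0"
    and Z0: "Z_vec br \<phi> \<xi> = 0"
begin

lemma br_xi_horizontal:
  assumes i: "i \<in> {1, 2, 3}" and X: "X \<in> horizontal \<eta>"
  shows "br (\<xi> i) X = 0"
proof -
  \<comment> \<open>The vanishing of \<open>psi\<close> is used at \<open>\<phi> i X\<close> instead
    of \<open>X\<close>, because \<open>\<phi> i\<close> applied to that vector gives back
    \<open>- X\<close>.\<close>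
  have "br (\<xi> i) (\<phi> i (\<phi> i X)) = 0"
    using psi_well_defined(1)[OF str ab i phi_horizontal[OF str i X]] psi0
      phi_horizontal[OF str i X] by simp
  moreover have "\<phi> i (\<phi> i X) = - X"
    using ac3_basic(3)[OF str i, of X] X i by (auto simp: horizontal_def)
  ultimately show ?thesis by (simp add: linear_neg[OF br_linear(1)[OF str]])
qed

lemma br_vertical_horizontal:
  assumes "U \<in> vertical \<xi>" "X \<in> horizontal \<eta>"
  shows "br U X = 0" "br X U = 0"
proof -
  show "br U X = 0"
    using assms(1) unfolding vertical_def
    by (rule linear_eq_0_on_span[OF br_linear(2)[OF str], rotated])
      (auto simp: br_xi_horizontal assms(2))
  then show "br X U = 0" using br_anti[OF str, of X U] by simp
qed

text \<open>Bilinear expansion in the frame of the \<open>\<xi> i\<close>; the coefficients form the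
  cross product of the coordinate vectors. Both cases rest on it: it vanishes for \<delta> = 0 and
  is a nonzero multiple of the cross product otherwise.\<close>

lemma br_vertical:
  assumes U: "U \<in> vertical \<xi>" and W: "W \<in> vertical \<xi>"
  shows "br U W = (2 * delta br \<xi> \<eta>) *\<^sub>R
    ((\<eta> 2 U * \<eta> 3 W - \<eta> 3 U * \<eta> 2 W) *\<^sub>R \<xi> 1 + (\<eta> 3 U * \<eta> 1 W - \<eta> 1 U * \<eta> 3 W) *\<^sub>R \<xi> 2 +
     (\<eta> 1 U * \<eta> 2 W - \<eta> 2 U * \<eta> 1 W) *\<^sub>R \<xi> 3)"
proof -
  \<comment> \<open>In the general formula for this bracket the term
    \<open>- \<phi> i (Z_vec br \<phi> \<xi>)\<close> disappears by \<open>Z0\<close>.\<close>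
  have xi: "br (\<xi> j) (\<xi> k) = (2 * delta br \<xi> \<eta>) *\<^sub>R \<xi> i"
      "br (\<xi> k) (\<xi> j) = - ((2 * delta br \<xi> \<eta>) *\<^sub>R \<xi> i)" if e: "(i, j, k) \<in> even_triples" for i j k
    using Z_delta_well_defined(3)[OF str ab e] Z0 br_anti[OF str, of "\<xi> k" "\<xi> j"]
      linear_0[OF ac3_basic(1)[OF str even_triples_rot(3)[OF str e]]] by simp_all
  note t = xi[of 1 2 3, simplified even_triples_def, simplified]
    xi[of 2 3 1, simplified even_triples_def, simplified]
    xi[of 3 1 2, simplified even_triples_def, simplified]
  note lin = linear_add[OF br_linear(1)[OF str]] linear_add[OF br_linear(2)[OF str]]
    linear_scale[OF br_linear(1)[OF str]] linear_scale[OF br_linear(2)[OF str]]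
  show ?thesis
    by (subst vertical_expansion[OF U], subst vertical_expansion[OF W])
      (simp add: lin t br_alt[OF str] algebra_simps)
qed

lemma br_vertical_closed:
  assumes "U \<in> vertical \<xi>" "W \<in> vertical \<xi>"
  shows "br U W \<in> vertical \<xi>"
  unfolding br_vertical[OF assms]
  by (intro subspace_scale subspace_add subspace_vertical xi_vertical) auto

text \<open>The mixed brackets vanish. This is the homomorphism property needed for the central
  extension as well as for the product.\<close>

lemma br_split:
  assumes "U \<in> vertical \<xi>" "X \<in> horizontal \<eta>" "W \<in> vertical \<xi>" "Y \<in> horizontal \<eta>"
  shows "br (U + X) (W + Y) = br U W + br X Y"
  using assms
  by (simp add: linear_add[OF br_linear(1)[OF str]] linear_add[OF br_linear(2)[OF str]]
      br_vertical_horizontal)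

lemma vertical_horizontal_split:
  obtains U X where "Y = U + X" "U \<in> vertical \<xi>" "X \<in> horizontal \<eta>"
  using hor_component_eq(2,3)[OF str, of Y] by (metis diff_add_cancel)

lemma lie_ideal_vertical: "lie_ideal br (vertical \<xi>)"
  unfolding lie_ideal_def
proof (intro conjI subspace_vertical allI ballI)
  fix Y W assume W: "W \<in> vertical \<xi>"
  obtain U X where "Y = U + X" "U \<in> vertical \<xi>" "X \<in> horizontal \<eta>"
    by (rule vertical_horizontal_split)
  then show "br Y W \<in> vertical \<xi>"
    using W br_vertical_closed
    by (simp add: linear_add[OF br_linear(2)[OF str]] br_vertical_horizontal)
qed

section \<open>The case \<delta> = 0: a central extension\<close>

lemma vertical_central:
  assumes d: "delta br \<xi> \<eta> = 0" shows "vertical \<xi> \<subseteq> lie_center br"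
  unfolding lie_center_def
proof clarify
  fix W Y assume W: "W \<in> vertical \<xi>"
  obtain U X where "Y = U + X" "U \<in> vertical \<xi>" "X \<in> horizontal \<eta>"
    by (rule vertical_horizontal_split)
  then show "br W Y = 0"
    using W d by (simp add: linear_add[OF br_linear(1)[OF str]] br_vertical_horizontal br_vertical)
qed

lemma br_hor_component:
  assumes d: "delta br \<xi> \<eta> = 0"
  shows "br (hor_component \<xi> \<eta> X) Y = br X Y" "br Y (hor_component \<xi> \<eta> X) = br Y X"
proof -
  have "br (X - hor_component \<xi> \<eta> X) Y = 0"
    using vertical_central[OF d] hor_component_eq(3)[OF str, of X] by (auto simp: lie_center_def)
  then show 1: "br (hor_component \<xi> \<eta> X) Y = br X Y"
    by (simp add: linear_diff[OF br_linear(2)[OF str]])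
  show "br Y (hor_component \<xi> \<eta> X) = br Y X"
    using 1 br_anti[OF str, of Y] by metis
qed

lemma jacobi: "br X (br Y Z) + br Y (br Z X) + br Z (br X Y) = 0"
  using lie_algebra_UNIV unfolding lie_algebra_on_def by blast

lemma lie_algebra_hor_bracket:
  assumes d: "delta br \<xi> \<eta> = 0"
  shows "lie_algebra_on (horizontal \<eta>) (hor_bracket br \<xi> \<eta>)"
proof -
  note lin = linear_add[OF br_linear(1)[OF str]] linear_add[OF br_linear(2)[OF str]]
    linear_scale[OF br_linear(1)[OF str]] linear_scale[OF br_linear(2)[OF str]]
    linear_add[OF linear_hor_component] linear_scale[OF linear_hor_component]
  \<comment> \<open>The projected Jacobi identity; the inner projections of the nested
    \<open>hor_bracket\<close> are absent thanks to \<open>br_hor_component\<close>.\<close>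
  have "hor_component \<xi> \<eta> (br X (br Y Z)) + hor_component \<xi> \<eta> (br Y (br Z X)) +
      hor_component \<xi> \<eta> (br Z (br X Y)) = 0" for X Y Z
    unfolding linear_add[OF linear_hor_component, symmetric] jacobi
    by (rule linear_0[OF linear_hor_component])
  then show ?thesis
    by (simp add: lie_algebra_on_def subspace_horizontal hor_bracket_def hor_component_eq(2)[OF str]
        bilinear_map_on_def linear_map_on_def lin br_alt[OF str] br_hor_component[OF d]
        linear_0[OF linear_hor_component])
qed

lemma two_cocycle_vertical_part:
  assumes d: "delta br \<xi> \<eta> = 0"
  shows "two_cocycle_on (horizontal \<eta>) (hor_bracket br \<xi> \<eta>) (vertical \<xi>)
    (\<lambda>X Y. br X Y - hor_bracket br \<xi> \<eta> X Y)"
proof -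
  let ?\<theta> = "\<lambda>X Y. br X Y - hor_bracket br \<xi> \<eta> X Y"
  note lin = linear_add[OF br_linear(1)[OF str]] linear_add[OF br_linear(2)[OF str]]
    linear_scale[OF br_linear(1)[OF str]] linear_scale[OF br_linear(2)[OF str]]
    linear_add[OF linear_hor_component] linear_scale[OF linear_hor_component]
  let ?v = "\<lambda>X. X - hor_component \<xi> \<eta> X"
  have v: "linear ?v" by (intro linear_compose_sub linear_ident linear_hor_component)
  \<comment> \<open>With the inner projection dropped, the left side is the vertical part of a
    double bracket; antisymmetry brings it into the nesting used in \<open>jacobi\<close>. The
    cocycle identity is then the vertical part of the Jacobi identity.\<close>
  have \<theta>: "?\<theta> (hor_bracket br \<xi> \<eta> X Y) Z = - ?v (br Z (br X Y))" for X Y Z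
    using br_anti[OF str, of "br X Y" Z]
    by (simp add: hor_bracket_def br_hor_component[OF d] linear_neg[OF linear_hor_component])
  have "?v (br Z (br X Y)) + ?v (br X (br Y Z)) + ?v (br Y (br Z X)) = 0" for X Y Z
    unfolding linear_add[OF v, symmetric] jacobi by (rule linear_0[OF v])
  then have "?\<theta> (hor_bracket br \<xi> \<eta> X Y) Z + ?\<theta> (hor_bracket br \<xi> \<eta> Y Z) X +
      ?\<theta> (hor_bracket br \<xi> \<eta> Z X) Y = 0" for X Y Z
    unfolding \<theta> minus_add_distrib[symmetric] neg_equal_0_iff_equal .
  moreover have "bilinear_map_on (horizontal \<eta>) ?\<theta>"
    by (simp add: bilinear_map_on_def linear_map_on_def hor_bracket_def lin algebra_simps)
  moreover have "?\<theta> X Y \<in> vertical \<xi>" "?\<theta> X X = 0" for X Y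
    using hor_component_eq(3)[OF str]
    by (simp_all add: hor_bracket_def br_alt[OF str] linear_0[OF linear_hor_component])
  ultimately show ?thesis unfolding two_cocycle_on_def by blast
qed

text \<open>The form depends on its arguments only through \<open>br X Y\<close>, which the abelian
  condition makes invariant on horizontal vectors.\<close>

lemma invariant_form_vertical_part:
  assumes i: "i \<in> {1, 2, 3}"
  shows "invariant_form_on (horizontal \<eta>) (\<phi> i) (\<lambda>X Y. br X Y - hor_bracket br \<xi> \<eta> X Y)"
proof -
  have "br (\<phi> i X) (\<phi> i Y) = br X Y" if "X \<in> horizontal \<eta>" "Y \<in> horizontal \<eta>" for X Y
    using ab_basic(2)[OF str ab i, of X Y] that i by (auto simp: horizontal_def)
  then show ?thesis by (simp add: invariant_form_on_def hor_bracket_def)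
qed

text \<open>By \<open>br_split\<close> and \<delta> = 0 the bracket of two sums is
  \<open>br X Y\<close>, and the two components of the extension bracket are its vertical and
  horizontal parts.\<close>

lemma lie_isomorphism_central_ext:
  assumes d: "delta br \<xi> \<eta> = 0"
  shows "lie_isomorphism (vertical \<xi> \<times> horizontal \<eta>)
    (central_ext_bracket (\<lambda>X Y. br X Y - hor_bracket br \<xi> \<eta> X Y) (hor_bracket br \<xi> \<eta>))
    UNIV br (\<lambda>(U, X). U + X)"
proof (rule lie_isomorphism_pullback)
  show "lie_algebra_on UNIV br" by (rule lie_algebra_UNIV)
  show "subspace (vertical \<xi> \<times> horizontal \<eta>)"
    by (intro subspace_Times subspace_vertical subspace_horizontal)
qed (auto simp: linear_map_on_add bij_betw_vertical_horizontal central_ext_bracket_def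
    hor_bracket_def hor_component_eq(2,3)[OF str] br_split br_vertical d)

section \<open>The case of nonzero \<delta>: a direct product\<close>

lemma br_horizontal_closed:
  assumes d: "delta br \<xi> \<eta> \<noteq> 0" and X: "X \<in> horizontal \<eta>" and Y: "Y \<in> horizontal \<eta>"
  shows "br X Y \<in> horizontal \<eta>"
proof -
  let ?Z = "br X Y" and ?h = "hor_component \<xi> \<eta>"
  have h: "?h ?Z \<in> horizontal \<eta>" and v: "?Z - ?h ?Z \<in> vertical \<xi>"
    by (rule hor_component_eq[OF str])+
  have zero: "br (\<xi> i) (?Z - ?h ?Z) = 0" if i: "i \<in> {1, 2, 3}" for i
  proof -
    \<comment> \<open>In the Jacobi identity for \<open>\<xi> i\<close>, \<open>X\<close>,
      \<open>Y\<close> the other two terms contain a bracket of \<open>\<xi> i\<close> with a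
      horizontal vector, hence vanish.\<close>
    have "br (\<xi> i) ?Z = 0"
      using jacobi[of "\<xi> i" X Y] br_vertical_horizontal[OF xi_vertical[OF i] X]
        br_vertical_horizontal[OF xi_vertical[OF i] Y]
      by (simp add: linear_0[OF br_linear(1)[OF str]])
    then show ?thesis
      using br_xi_horizontal[OF i h] by (simp add: linear_diff[OF br_linear(1)[OF str]])
  qed
  have eta: "\<eta> i (?Z - ?h ?Z) = \<eta> i ?Z" if "i \<in> {1, 2, 3}" for i
    using h that by (auto simp: linear_diff[OF ac3_basic(2)[OF str that]] horizontal_def)
  note e = linear_diff[OF ac3_basic(2)[OF str]] linear_add[OF ac3_basic(2)[OF str]]
    linear_scale[OF ac3_basic(2)[OF str]] linear_0[OF ac3_basic(2)[OF str]] eta_xi[OF str]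
  \<comment> \<open>Up to the nonzero factor \<open>2 * delta br \<xi> \<eta>\<close> and sign, this
    is the cross product of the second basis vector with the coordinates of the vertical part. It
    loses coordinate 2, which the bracket with \<open>\<xi> 1\<close> recovers.\<close>
  have "\<eta> 1 ?Z *\<^sub>R \<xi> 3 - \<eta> 3 ?Z *\<^sub>R \<xi> 1 = 0"
    using zero[of 2] d eta by (simp add: br_vertical[OF xi_vertical v] eta_xi[OF str])
  moreover have "\<eta> 2 ?Z *\<^sub>R \<xi> 3 - \<eta> 3 ?Z *\<^sub>R \<xi> 2 = 0"
    using zero[of 1] d eta by (simp add: br_vertical[OF xi_vertical v] eta_xi[OF str])
  \<comment> \<open>Applying the dual forms \<open>\<eta> i\<close> reads off the
    coefficients.\<close>
  ultimately have "\<eta> i (\<eta> 1 ?Z *\<^sub>R \<xi> 3 - \<eta> 3 ?Z *\<^sub>R \<xi> 1) = 0"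
      "\<eta> i (\<eta> 2 ?Z *\<^sub>R \<xi> 3 - \<eta> 3 ?Z *\<^sub>R \<xi> 2) = 0" if "i \<in> {1, 2, 3}" for i
    using linear_0[OF ac3_basic(2)[OF str that]] by simp_all
  from this[of 1] this[of 2] this[of 3] have "\<eta> 1 ?Z = 0" "\<eta> 2 ?Z = 0" "\<eta> 3 ?Z = 0"
    by (simp_all add: e)
  then show ?thesis by (simp add: horizontal_def)
qed

lemma lie_ideal_horizontal:
  assumes d: "delta br \<xi> \<eta> \<noteq> 0" shows "lie_ideal br (horizontal \<eta>)"
  unfolding lie_ideal_def
proof (intro conjI subspace_horizontal allI ballI)
  fix Y W assume W: "W \<in> horizontal \<eta>"
  obtain U X where "Y = U + X" "U \<in> vertical \<xi>" "X \<in> horizontal \<eta>"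
    by (rule vertical_horizontal_split)
  then show "br Y W \<in> horizontal \<eta>"
    using W br_horizontal_closed[OF d]
    by (simp add: linear_add[OF br_linear(2)[OF str]] br_vertical_horizontal)
qed

lemma lie_isomorphism_product:
  assumes d: "delta br \<xi> \<eta> \<noteq> 0"
  shows "lie_isomorphism (vertical \<xi> \<times> horizontal \<eta>) (product_bracket br br)
    UNIV br (\<lambda>(U, X). U + X)"
proof (rule lie_isomorphism_pullback)
  show "lie_algebra_on UNIV br" by (rule lie_algebra_UNIV)
  show "subspace (vertical \<xi> \<times> horizontal \<eta>)"
    by (intro subspace_Times subspace_vertical subspace_horizontal)
qed (auto simp: linear_map_on_add bij_betw_vertical_horizontal product_bracket_def
    br_split br_vertical_closed br_horizontal_closed[OF d])

lemma lie_isomorphic_vertical_so3: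
  assumes d: "delta br \<xi> \<eta> \<noteq> 0"
  shows "lie_isomorphic (vertical \<xi>) br so3 matrix_commutator"
proof -
  let ?d = "2 * delta br \<xi> \<eta>"
  \<comment> \<open>The factor \<open>?d\<close> normalizes the bracket: in plain coordinates it is
    \<open>?d\<close> times the cross product, and after rescaling both sides of the homomorphism
    equation carry the square of \<open>?d\<close>. This works for either sign of \<delta>.\<close>
  define c :: "'a \<Rightarrow> real^3" where "c U = ?d *\<^sub>R vector [\<eta> 1 U, \<eta> 2 U, \<eta> 3 U]" for U
  note e = linear_add[OF ac3_basic(2)[OF str]] linear_scale[OF ac3_basic(2)[OF str]]
    eta_xi[OF str]
  have lin: "linear c"
    by (rule linearI) (simp_all add: c_def vec_eq_iff forall_3 e algebra_simps)
  have bij: "bij_betw c (vertical \<xi>) UNIV"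
  proof (rule bij_betw_byWitness)
    let ?g = "\<lambda>w. (w$1 / ?d) *\<^sub>R \<xi> 1 + (w$2 / ?d) *\<^sub>R \<xi> 2 + (w$3 / ?d) *\<^sub>R \<xi> 3"
    show "\<forall>U\<in>vertical \<xi>. ?g (c U) = U"
      using d vertical_expansion by (simp add: c_def)
    show "\<forall>w\<in>UNIV. c (?g w) = w"
      using d by (simp add: c_def vec_eq_iff forall_3 e)
    show "?g ` UNIV \<subseteq> vertical \<xi>"
      by (intro image_subsetI subspace_add subspace_scale subspace_vertical xi_vertical) auto
  qed simp
  have hom: "c (br U W) = cross3 (c U) (c W)" if "U \<in> vertical \<xi>" "W \<in> vertical \<xi>" for U W
    unfolding br_vertical[OF that]
    by (simp add: c_def cross3_def vec_eq_iff forall_3 e) (simp add: algebra_simps)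
  have "lie_isomorphism (vertical \<xi>) br so3 matrix_commutator (skew_matrix \<circ> c)"
  proof (rule lie_isomorphism_pullback[OF lie_algebra_so3 subspace_vertical])
    show "bij_betw (skew_matrix \<circ> c) (vertical \<xi>) so3"
      by (rule bij_betw_trans[OF bij bij_betw_skew_matrix])
    show "linear_map_on (vertical \<xi>) (skew_matrix \<circ> c)"
      using linear_compose[OF lin linear_skew_matrix]
      by (simp add: linear_map_on_def linear_add linear_scale lin linear_skew_matrix)
  qed (simp_all add: br_vertical_closed hom skew_matrix_cross3)
  then show ?thesis unfolding lie_isomorphic_def by blast
qed

end

end

theorem proposition5p2:
  fixes n :: nat
    and br :: "'a::real_vector \<Rightarrow> 'a \<Rightarrow> 'a"
    and \<phi> :: "nat \<Rightarrow> 'a \<Rightarrow> 'a"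
    and \<xi> :: "nat \<Rightarrow> 'a"
    and \<eta> :: "nat \<Rightarrow> 'a \<Rightarrow> real"
  assumes "almost_3_contact_lie_algebra n br \<phi> \<xi> \<eta>"
    and "abelian_3_contact br \<phi> \<xi> \<eta>"
    and "\<forall>X\<in>horizontal \<eta>. psi br \<phi> \<xi> X = 0"
    and "Z_vec br \<phi> \<xi> = 0"
  shows "(delta br \<xi> \<eta> = 0 \<longrightarrow>
            vertical \<xi> \<subseteq> lie_center br \<and>
            lie_algebra_on (horizontal \<eta>) (hor_bracket br \<xi> \<eta>) \<and>
            (\<exists>\<theta>. two_cocycle_on (horizontal \<eta>) (hor_bracket br \<xi> \<eta>) (vertical \<xi>) \<theta> \<and>
                 (\<forall>i\<in>{1, 2, 3}. invariant_form_on (horizontal \<eta>) (\<phi> i) \<theta>) \<and>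
                 lie_isomorphism (vertical \<xi> \<times> horizontal \<eta>)
                   (central_ext_bracket \<theta> (hor_bracket br \<xi> \<eta>)) UNIV br (\<lambda>(U, X). U + X))) \<and>
         (delta br \<xi> \<eta> \<noteq> 0 \<longrightarrow>
            lie_ideal br (vertical \<xi>) \<and> lie_ideal br (horizontal \<eta>) \<and>
            lie_isomorphism (vertical \<xi> \<times> horizontal \<eta>)
              (product_bracket br br) UNIV br (\<lambda>(U, X). U + X) \<and>
            lie_isomorphic (vertical \<xi>) br so3 matrix_commutator \<and>
            (\<exists>J1 J2 J3. abelian_hypercomplex_on (horizontal \<eta>) br J1 J2 J3))"
  using vertical_central[OF assms] lie_algebra_hor_bracket[OF assms]
    two_cocycle_vertical_part[OF assms] invariant_form_vertical_part[OF assms]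
    lie_isomorphism_central_ext[OF assms] lie_ideal_vertical[OF assms]
    lie_ideal_horizontal[OF assms] lie_isomorphism_product[OF assms]
    lie_isomorphic_vertical_so3[OF assms] abelian_hypercomplex_horizontal[OF assms(1,2)]
  by blast

end
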